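(* Let $d\ge2$ and $p\ge2$ be integers, and let $R_1^p(z)=\sum_j(z-\lambda_j^p)_+$ be the first Riesz-mean of the eigenvalues of the polyharmonic operator $(-\Delta)^p$ on $\mathbb{S}^d$. Put $z_d=\frac{d(2d-1)}{12}$. For all $z\ge0$, $$ R_1^p(z)\geq L^{class}_{1,d,p}|\mathbb{S}^d|z^{1+\frac{d}{2p}}-\frac{2(p-1)}{d+2}L^{class}_{1,d,p}|\mathbb{S}^d|\left(\left(z^{\frac1p}+z_d\right)^{\frac d2+p}-z^{1+\frac{d}{2p}}\right) $$ and $$ R_1^p(z)\leq L^{class}_{1,d,p}|\mathbb{S}^d|\left(z^{\frac1p}+z_d\right)^{\frac d2+p}+\frac{2(p-1)}{d+2}L^{class}_{1,d,p}|\mathbb{S}^d|\left(\left(z^{\frac1p}+z_d\right)^{\frac d2+p}-z^{1+\frac{d}{2p}}\right). $$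
   Context: $\mathbb{S}^d$ is the round unit sphere in $\mathbb{R}^{d+1}$. The $\lambda_j$ are the eigenvalues of $-\Delta$ on $\mathbb{S}^d$ counted with multiplicity: the distinct values are $\lambda_{(l)}=l(l+d-1)$, $l\in\mathbb{N}=\{0,1,2,\dots\}$, with multiplicity $m_{l,d}=\binom{d+l}{l}-\binom{d+l-2}{l-2}$ (a binomial coefficient with negative lower entry being $0$). The eigenvalues of $(-\Delta)^p$ are the $\lambda_j^p$, with the same multiplicities; $a_+=\max(a,0)$. The semiclassical constant is $$L^{class}_{\gamma,d,p}=(4\pi)^{-d/2}\frac{\Gamma(\gamma+1)\Gamma(1+\frac{d}{2p})}{\Gamma(1+\frac d2)\Gamma(1+\gamma+\frac{d}{2p})}.$$ *)

theory Defs
  imports "HOL-Analysis.Analysis"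
begin

definition sphere_eigval :: "nat \<Rightarrow> nat \<Rightarrow> real" where
  "sphere_eigval d l = real l * (real l + real d - 1)"

definition sphere_mult :: "nat \<Rightarrow> nat \<Rightarrow> nat" where
  "sphere_mult d l = ((d + l) choose l) - (if l < 2 then 0 else (d + l - 2) choose (l - 2))"

text \<open>
  The eigenvalues of minus the Laplacian on the unit \<open>d\<close>-sphere, listed in nondecreasing
  order and repeated according to multiplicity, with indices starting at 0: the \<open>j\<close>-th one
  is the value of the first level \<open>l\<close> at which the counting function exceeds \<open>j\<close>.
  Lemma \<open>card_sphere_eigenvalue_eq\<close> below confirms the multiplicities.
\<close>

definition sphere_level :: "nat \<Rightarrow> nat \<Rightarrow> nat" where
  "sphere_level d j = (LEAST l. j < (\<Sum>i\<le>l. sphere_mult d i))"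

definition sphere_eigenvalue :: "nat \<Rightarrow> nat \<Rightarrow> real" where
  "sphere_eigenvalue d j = sphere_eigval d (sphere_level d j)"

text \<open>
  The sum has only finitely many nonzero terms (lemma \<open>finite_riesz_support\<close>).
\<close>

definition riesz_mean1 :: "nat \<Rightarrow> nat \<Rightarrow> real \<Rightarrow> real" where
  "riesz_mean1 d p z = (\<Sum>j. max (z - sphere_eigenvalue d j ^ p) 0)"

definition L_class :: "real \<Rightarrow> nat \<Rightarrow> nat \<Rightarrow> real" where
  "L_class \<gamma> d p =
     (4 * pi) powr (- (real d / 2)) *
     (Gamma (\<gamma> + 1) * Gamma (1 + real d / (2 * real p))) /
     (Gamma (1 + real d / 2) * Gamma (1 + \<gamma> + real d / (2 * real p)))"

definition z_shift :: "nat \<Rightarrow> real" where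
  "z_shift d = real d * (2 * real d - 1) / 12"

text \<open>
  Surface measure of the unit \<open>d\<close>-sphere: the ball of radius \<open>r\<close> in dimension \<open>d + 1\<close> has
  volume \<open>unit_ball_vol (d + 1) * r ^ (d + 1)\<close>, and its derivative in \<open>r\<close> at \<open>r = 1\<close> is the
  area of the bounding sphere (see \<open>has_derivative_ball_volume\<close> and \<open>sphere_area_Gamma\<close>).
\<close>

definition sphere_area :: "nat \<Rightarrow> real" where
  "sphere_area d = real (d + 1) * unit_ball_vol (real (d + 1))"

lemma has_derivative_ball_volume:
  assumes "DIM('a::euclidean_space) = d + 1"
  shows "((\<lambda>r. measure lborel (ball (0::'a) r)) has_real_derivative sphere_area d) (at 1)"
proof -
  have "((\<lambda>r. unit_ball_vol (real (d + 1)) * r ^ (d + 1)) has_real_derivative sphere_area d) (at 1)"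
    unfolding sphere_area_def by (auto intro!: derivative_eq_intros)
  moreover have "\<forall>\<^sub>F r in nhds (1::real).
      measure lborel (ball (0::'a) r) = unit_ball_vol (real (d + 1)) * r ^ (d + 1)"
    using eventually_nhds_in_open[of "{0<..}" "1::real"]
    by (rule eventually_mono[OF _ _]) (auto simp: content_ball assms)
  ultimately show ?thesis
    by (subst DERIV_cong_ev[OF refl _ refl]) auto
qed

lemma sphere_area_Gamma:
  "sphere_area d = 2 * pi powr ((real d + 1) / 2) / Gamma ((real d + 1) / 2)"
proof -
  define x where "x = (real d + 1) / 2"
  have "x > 0" by (simp add: x_def)
  then have "Gamma (x + 1) = x * Gamma x" "Gamma x > 0"
    by (auto intro!: Gamma_plus1 Gamma_real_pos simp: nonpos_Ints_def)
  then have "2 * x * (pi powr x / Gamma (x + 1)) = 2 * pi powr x / Gamma x"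
    using \<open>x > 0\<close> by (simp add: field_simps)
  moreover have "real (d + 1) = 2 * x"
    by (simp add: x_def)
  ultimately show ?thesis
    unfolding sphere_area_def unit_ball_vol_def x_def[symmetric] by simp
qed

lemma sphere_mult_real:
  "real (sphere_mult d l) =
     real ((d + l) choose l) - (if l < 2 then 0 else real ((d + l - 2) choose (l - 2)))"
proof (cases "l < 2")
  case False
  then obtain k where l: "l = k + 2"
    by (metis add.commute le_Suc_ex not_less)
  have "(d + k) choose k \<le> Suc (d + k) choose Suc k"
    by simp
  also have "\<dots> \<le> Suc (Suc (d + k)) choose Suc (Suc k)"
    by simp
  finally show ?thesis
    by (simp add: sphere_mult_def l of_nat_diff)
qed (simp add: sphere_mult_def)

lemma sphere_mult_pos:
  assumes "d \<ge> 1"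
  shows "sphere_mult d l > 0"
proof (cases "l < 2")
  case False
  then obtain k where l: "l = k + 2"
    by (metis add.commute le_Suc_ex not_less)
  have "(d + k) choose k \<le> Suc (d + k) choose Suc k"
    by simp
  also have "\<dots> < Suc (Suc (d + k)) choose Suc (Suc k)"
    using assms by (simp add: zero_less_binomial_iff)
  finally show ?thesis
    by (simp add: sphere_mult_def l)
qed (simp add: sphere_mult_def)

lemma sphere_level_eq_iff:
  assumes "d \<ge> 1"
  shows "sphere_level d j = l \<longleftrightarrow>
    (\<Sum>i<l. sphere_mult d i) \<le> j \<and> j < (\<Sum>i\<le>l. sphere_mult d i)"
proof -
  let ?N = "\<lambda>l. \<Sum>i\<le>l. sphere_mult d i"
  have mono: "?N a \<le> ?N b" if "a \<le> b" for a b
    using that by (intro sum_mono2) auto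
  have "l < ?N l" for l
  proof (induction l)
    case (Suc l)
    then show ?case using sphere_mult_pos[OF assms, of "Suc l"] by simp
  qed (simp add: sphere_mult_pos[OF assms])
  then have ex: "j < ?N (sphere_level d j)"
    unfolding sphere_level_def by (rule LeastI)
  have least: "sphere_level d j \<le> k" if "j < ?N k" for k
    unfolding sphere_level_def using that by (rule Least_le)
  have lower: "(\<Sum>i<k. sphere_mult d i) \<le> j \<longleftrightarrow> (\<forall>m<k. \<not> j < ?N m)" for k
  proof (cases k)
    case (Suc k')
    then show ?thesis
      using mono[of _ k'] by (auto simp: lessThan_Suc_atMost not_less less_Suc_eq_le intro: order_trans)
  qed simp
  show ?thesis
    unfolding lower using ex least by (metis le_neq_implies_less not_less)
qed

lemma sphere_level_mono:
  assumes "d \<ge> 1" "i \<le> j"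
  shows "sphere_level d i \<le> sphere_level d j"
proof -
  have "i < (\<Sum>k\<le>sphere_level d j. sphere_mult d k)"
    using sphere_level_eq_iff[OF assms(1), of j "sphere_level d j"] assms(2) by simp
  then show ?thesis
    unfolding sphere_level_def[of d i] by (rule Least_le)
qed

lemma strict_mono_sphere_eigval:
  assumes "d \<ge> 1"
  shows "strict_mono (sphere_eigval d)"
proof (rule strict_monoI)
  fix k l :: nat
  assume "k < l"
  then show "sphere_eigval d k < sphere_eigval d l"
    using assms unfolding sphere_eigval_def by (intro mult_strict_mono') auto
qed

lemma sphere_eigenvalue_eq_iff:
  assumes "d \<ge> 1"
  shows "sphere_eigenvalue d j = sphere_eigval d l \<longleftrightarrow> sphere_level d j = l"
  unfolding sphere_eigenvalue_def
  using strict_mono_sphere_eigval[OF assms] by (simp add: strict_mono_eq)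

lemma mono_sphere_eigenvalue:
  assumes "d \<ge> 1"
  shows "mono (sphere_eigenvalue d)"
  unfolding sphere_eigenvalue_def
  by (intro monoI monoD[OF strict_mono_mono[OF strict_mono_sphere_eigval]] sphere_level_mono assms)

lemma card_sphere_eigenvalue_eq:
  assumes "d \<ge> 1"
  shows "card {j. sphere_eigenvalue d j = sphere_eigval d l} = sphere_mult d l"
proof -
  have "{j. sphere_eigenvalue d j = sphere_eigval d l} =
      {(\<Sum>i<l. sphere_mult d i)..<(\<Sum>i\<le>l. sphere_mult d i)}"
    unfolding sphere_eigenvalue_eq_iff[OF assms] sphere_level_eq_iff[OF assms] by auto
  then show ?thesis
    by (simp add: lessThan_Suc_atMost[symmetric])
qed

lemma finite_riesz_support:
  assumes "d \<ge> 1" "p \<ge> 1"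
  shows "finite {j. max (z - sphere_eigenvalue d j ^ p) 0 \<noteq> 0}"
proof -
  obtain n :: nat where n: "real n > max z 1"
    using reals_Archimedean2 by blast
  have "{j. max (z - sphere_eigenvalue d j ^ p) 0 \<noteq> 0} \<subseteq> {..<(\<Sum>i<n. sphere_mult d i)}"
  proof (rule subsetI, rule ccontr)
    fix j
    assume j: "j \<in> {j. max (z - sphere_eigenvalue d j ^ p) 0 \<noteq> 0}"
      and "j \<notin> {..<(\<Sum>i<n. sphere_mult d i)}"
    then have "\<not> sphere_level d j < n"
      using sphere_level_eq_iff[OF assms(1), of j "sphere_level d j"]
        sum_mono2[of "{..<n}" "{..sphere_level d j}" "sphere_mult d"] by fastforce
    then have "real n \<le> real (sphere_level d j)"
      by simp
    then have "real n * 1 \<le> sphere_eigenvalue d j"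
      unfolding sphere_eigenvalue_def sphere_eigval_def
      using assms n by (intro mult_mono) auto
    moreover from this n have "sphere_eigenvalue d j ^ 1 \<le> sphere_eigenvalue d j ^ p"
      using assms by (intro power_increasing) auto
    ultimately show False
      using j n by (auto simp: max_def split: if_splits)
  qed
  then show ?thesis
    by (rule finite_subset) simp
qed

end

theory Submission
  imports Defs
begin

text \<open>
  The case \<open>p = 1\<close> carries the analysis. There the claim is
  \<open>C * z powr (1 + d/2) \<le> R z \<le> C * (z + z_shift d) powr (1 + d/2)\<close> with
  \<open>C = 4 / ((d + 2) * d!)\<close>, which is the semiclassical constant times the area of the sphere.
  The function \<open>R\<close> is piecewise affine with kinks at the eigenvalues, and both its slopes (the
  counting function) and its values at the kinks have closed product forms
  (\<open>sum_sphere_mult_pochhammer\<close>, \<open>riesz_mean1_eigval\<close>). Since the comparison functions are convex,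
  two elementary facts suffice.

  Lower bound (\<open>riesz_mean1_laplacian_ge\<close>): a convex function lies below its chords, so only the
  kinks matter. There the product \<open>l (l + 1) \<cdots> (l + d - 1)\<close> has to be at least
  \<open>\<lambda> powr (d/2)\<close>, where \<open>\<lambda> = l (l + d - 1)\<close>; pairing the factors \<open>l + i\<close> and \<open>l + d - 1 - i\<close> shows
  this.

  Upper bound (\<open>riesz_mean1_laplacian_le\<close>): a convex function lies above its tangents, so each affine
  piece is compared with the tangent of the same slope. The point of tangency is a \<open>d\<close>-th root of
  a product of \<open>d\<close> factors, and the inequality of arithmetic and geometric means bounds it
  (\<open>slope_root_le\<close>). The value of \<open>z_shift d\<close> is exactly the one for which the remaining polynomial
  inequality is an identity.

  For general \<open>p\<close>, put \<open>z = w ^ p\<close>. Taylor's formula with integral remainder for \<open>t ^ p\<close>, applied to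
  each eigenvalue, gives
  \<open>R\<^sub>p (w ^ p) = p w ^ (p - 1) R w - \<integral> p (p - 1) t ^ (p - 2) R t dt\<close>, the integral being over
  \<open>[0, w]\<close> (\<open>riesz_mean1_power_integral\<close>). Each bound for \<open>R\<^sub>p\<close> uses one of the two bounds for \<open>R\<close> in
  the boundary term and the other one under the integral; this mixture produces the correction
  term with the factor \<open>2 (p - 1) / (d + 2)\<close>.
\<close>

section \<open>The semiclassical constant\<close>

text \<open>
  An instance of Legendre's duplication formula; at half-integers the functional equation of
  \<open>Gamma\<close> suffices, because raising \<open>d\<close> by one swaps the two arguments and adds 1 to one of them.
\<close>

lemma Gamma_half_product:
  "Gamma ((real d + 1) / 2) * Gamma (1 + real d / 2) = sqrt pi * fact d / 2 ^ d"
proof (induction d)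
  case 0
  then show ?case by (simp add: Gamma_one_half_real)
next
  case (Suc d)
  have step: "Gamma ((real d + 1) / 2 + 1) = (real d + 1) / 2 * Gamma ((real d + 1) / 2)"
    by (rule Gamma_plus1) (auto simp: nonpos_Ints_def)
  have args: "1 + real (Suc d) / 2 = (real d + 1) / 2 + 1"
    "(real (Suc d) + 1) / 2 = 1 + real d / 2"
    by (simp_all add: field_simps)
  have "Gamma ((real (Suc d) + 1) / 2) * Gamma (1 + real (Suc d) / 2)
      = (real d + 1) / 2 * (Gamma ((real d + 1) / 2) * Gamma (1 + real d / 2))"
    unfolding args step by (simp only: mult_ac)
  also have "\<dots> = sqrt pi * fact (Suc d) / 2 ^ Suc d"
    unfolding Suc.IH by (simp add: field_simps)
  finally show ?case .
qed

text \<open>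
  The powers of \<open>\<pi>\<close> and the values of \<open>Gamma\<close> at half-integers cancel, so this constant can be
  compared with the elementary product formulas for the Riesz means.
\<close>

lemma L_class_times_sphere_area:
  assumes "p \<ge> 1"
  shows "L_class 1 d p * sphere_area d = 4 * real p / (fact d * (2 * real p + real d))"
proof -
  define x where "x = 1 + real d / (2 * real p)"
  have "x > 0" using assms by (simp add: x_def add_pos_nonneg)
  then have ratio: "Gamma (1 + x) = x * Gamma x" "Gamma x > 0"
    using Gamma_plus1[of x] by (auto intro!: Gamma_real_pos simp: nonpos_Ints_def add.commute)
  have powers: "(4 * pi) powr (- (real d / 2)) * pi powr ((real d + 1) / 2) = sqrt pi / 2 ^ d"
  proof -
    have "(4::real) powr (real d / 2) = (2 powr 2) powr (real d / 2)"
      by simp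
    also have "\<dots> = 2 ^ d"
      by (subst powr_powr) (simp add: powr_realpow)
    finally have "(4::real) powr (real d / 2) = 2 ^ d" .
    moreover have "pi powr ((real d + 1) / 2) = pi powr (real d / 2) * sqrt pi"
      by (simp add: add_divide_distrib powr_add powr_half_sqrt)
    ultimately show ?thesis
      by (simp add: powr_minus powr_mult field_simps)
  qed
  have "Gamma (1 + 1 + real d / (2 * real p)) = x * Gamma x"
    unfolding ratio(1)[symmetric] by (simp add: x_def)
  moreover have "Gamma (1 + 1 :: real) = 1"
    using Gamma_fact[of 1, where 'a = real] by simp
  ultimately have L: "L_class 1 d p = (4 * pi) powr (- (real d / 2)) / (x * Gamma (1 + real d / 2))"
    using ratio(2) unfolding L_class_def x_def[symmetric] by simp
  have "L_class 1 d p * sphere_area d =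
      2 * ((4 * pi) powr (- (real d / 2)) * pi powr ((real d + 1) / 2)) /
      (x * (Gamma ((real d + 1) / 2) * Gamma (1 + real d / 2)))"
    unfolding L sphere_area_Gamma by (simp add: mult_ac)
  also have "\<dots> = 2 / (x * fact d)"
    unfolding powers Gamma_half_product by (simp add: field_simps)
  also have "\<dots> = 4 * real p / (fact d * (2 * real p + real d))"
    using assms by (simp add: x_def field_simps)
  finally show ?thesis .
qed

section \<open>Counting function and Riesz means by levels\<close>

text \<open>
  Converts sums over the eigenvalue index into sums over levels: the indices of level \<open>n\<close> form the
  block between two consecutive partial sums of the multiplicities.
\<close>

lemma sum_sphere_level:
  fixes f :: "nat \<Rightarrow> real"
  assumes "d \<ge> 1"
  shows "(\<Sum>j<(\<Sum>i<n. sphere_mult d i). f (sphere_level d j)) = (\<Sum>i<n. real (sphere_mult d i) * f i)"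
proof (induction n)
  case (Suc n)
  let ?N = "\<lambda>n. \<Sum>i<n. sphere_mult d i"
  have "{..<?N (Suc n)} = {..<?N n} \<union> {?N n..<?N (Suc n)}" by auto
  then have "(\<Sum>j<?N (Suc n). f (sphere_level d j)) =
      (\<Sum>j<?N n. f (sphere_level d j)) + (\<Sum>j\<in>{?N n..<?N (Suc n)}. f (sphere_level d j))"
    by (simp add: sum.union_disjoint ivl_disj_int del: sum.lessThan_Suc)
  also have "(\<Sum>j\<in>{?N n..<?N (Suc n)}. f (sphere_level d j)) = (\<Sum>j\<in>{?N n..<?N (Suc n)}. f n)"
  proof (intro sum.cong refl)
    fix j assume "j \<in> {?N n..<?N (Suc n)}"
    then have "sphere_level d j = n"
      unfolding sphere_level_eq_iff[OF assms] by (simp add: lessThan_Suc_atMost[symmetric])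
    then show "f (sphere_level d j) = f n" by simp
  qed
  finally show ?case using Suc by simp
qed simp

lemma riesz_mean1_eq_sum:
  assumes "d \<ge> 1" and large: "\<And>l. l \<ge> n \<Longrightarrow> z \<le> sphere_eigval d l ^ p"
  shows "riesz_mean1 d p z =
    (\<Sum>i<n. real (sphere_mult d i) * max (z - sphere_eigval d i ^ p) 0)"
proof -
  let ?N = "\<Sum>i<n. sphere_mult d i"
  have "max (z - sphere_eigenvalue d j ^ p) 0 = 0" if "j \<notin> {..<?N}" for j
  proof -
    have "\<not> sphere_level d j < n"
    proof
      assume "sphere_level d j < n"
      then have "(\<Sum>i\<le>sphere_level d j. sphere_mult d i) \<le> ?N"
        by (intro sum_mono2) auto
      then show False
        using that sphere_level_eq_iff[OF assms(1), of j "sphere_level d j"] by auto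
    qed
    then show ?thesis
      using large[of "sphere_level d j"] by (simp add: sphere_eigenvalue_def)
  qed
  then have "riesz_mean1 d p z = (\<Sum>j<?N. max (z - sphere_eigenvalue d j ^ p) 0)"
    unfolding riesz_mean1_def by (intro suminf_finite) auto
  also have "\<dots> = (\<Sum>i<n. real (sphere_mult d i) * max (z - sphere_eigval d i ^ p) 0)"
    unfolding sphere_eigenvalue_def
    by (rule sum_sphere_level[OF assms(1), of "\<lambda>l. max (z - sphere_eigval d l ^ p) 0"])
  finally show ?thesis .
qed

lemma sphere_eigval_nonneg: "d \<ge> 1 \<Longrightarrow> sphere_eigval d l \<ge> 0"
  unfolding sphere_eigval_def by simp

lemma sphere_eigval_ge_level: "d \<ge> 1 \<Longrightarrow> real l \<le> sphere_eigval d l"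
  unfolding sphere_eigval_def using mult_left_mono[of 1 "real l + real d - 1" "real l"]
  by (cases l) auto

lemma sphere_eigval_mono: "d \<ge> 1 \<Longrightarrow> k \<le> l \<Longrightarrow> sphere_eigval d k \<le> sphere_eigval d l"
  using strict_mono_sphere_eigval by (simp add: strict_mono_less_eq)

text \<open>
  The sum telescopes, since \<open>sphere_mult d l\<close> is the difference of the values of
  \<open>(d + k) choose d\<close> at \<open>k = l\<close> and \<open>k = l - 2\<close>.
\<close>

lemma sum_sphere_mult:
  assumes "d \<ge> 1"
  shows "(\<Sum>i\<le>l. real (sphere_mult d i)) = real ((d + l) choose d) + real ((d + l - 1) choose d)"
proof (induction l)
  case 0
  then show ?case using assms by (simp add: sphere_mult_def)
next
  case (Suc l)
  have eq: "((d + k) choose k) = ((d + k) choose d)" for k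
    using binomial_symmetric[of k "d + k"] by simp
  show ?case
  proof (cases l)
    case 0
    then show ?thesis using Suc assms by (simp add: sphere_mult_def)
  next
    case (Suc k)
    then have "real (sphere_mult d (Suc l)) =
        real ((d + Suc l) choose d) - real ((d + l - 1) choose d)"
      using eq[of "Suc l"] eq[of k] by (simp add: sphere_mult_real)
    then show ?thesis using Suc.IH by simp
  qed
qed

lemma sum_sphere_mult_pochhammer:
  assumes "d \<ge> 1"
  shows "(\<Sum>i\<le>l. real (sphere_mult d i)) =
    (2 * real l + real d) * pochhammer (real l + 1) (d - 1) / fact d"
proof -
  obtain e where e: "d = Suc e" using assms by (cases d) auto
  have "real ((d + l) choose d) = pochhammer (real l + 1) d / fact d"
    by (simp add: binomial_gbinomial gbinomial_pochhammer' add_ac)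
  moreover have "real ((d + l - 1) choose d) = pochhammer (real l) d / fact d"
    using e by (simp add: binomial_gbinomial gbinomial_pochhammer' add_ac)
  moreover have "pochhammer (real l) d = real l * pochhammer (real l + 1) e"
    unfolding e by (rule pochhammer_rec)
  moreover have "pochhammer (real l + 1) d = (real l + real d) * pochhammer (real l + 1) e"
    unfolding e by (simp add: pochhammer_Suc)
  ultimately show ?thesis
    unfolding sum_sphere_mult[OF assms]
    by (simp add: e add_divide_distrib[symmetric] distrib_right del: binomial_Suc_Suc pochhammer_Suc)
qed

text \<open>
  The closed form comes from solving \<open>T (l + 1) - T l = N l * (\<lambda>\<^bsub>l+1\<^esub> - \<lambda>\<^bsub>l\<^esub>)\<close>, where \<open>N l\<close> counts the
  eigenvalues up to level \<open>l\<close>, by a multiple of \<open>pochhammer l d\<close> with a quadratic cofactor; the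
  coefficients of the cofactor are forced, and it turns out to depend on \<open>l\<close> only through the
  eigenvalue.
\<close>

lemma riesz_mean1_eigval:
  assumes "d \<ge> 1"
  shows "riesz_mean1 d 1 (sphere_eigval d l) =
    4 / ((real d + 2) * fact d) * pochhammer (real l) d
      * (sphere_eigval d l + real d * (real d - 2) / 4)"
proof -
  obtain e where e: "d = Suc e" using assms by (cases d) auto
  define T where "T l = (\<Sum>i<l. real (sphere_mult d i) * (sphere_eigval d l - sphere_eigval d i))" for l
  have "riesz_mean1 d 1 (sphere_eigval d l) = T l"
    unfolding T_def using sphere_eigval_mono[OF assms]
    by (subst riesz_mean1_eq_sum[OF assms, of l]) (auto intro!: sum.cong)
  also have "T l = 4 / ((real d + 2) * fact d) * pochhammer (real l) d
      * (sphere_eigval d l + real d * (real d - 2) / 4)"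
  proof (induction l)
    case 0
    then show ?case by (simp add: T_def e pochhammer_rec)
  next
    case (Suc l)
    let ?Q = "pochhammer (real l + 1) e"
    have "T (Suc l) = (\<Sum>i\<le>l. real (sphere_mult d i) * (sphere_eigval d l - sphere_eigval d i))
        + (sphere_eigval d (Suc l) - sphere_eigval d l) * (\<Sum>i\<le>l. real (sphere_mult d i))"
      unfolding T_def lessThan_Suc_atMost sum_distrib_left sum.distrib[symmetric]
      by (intro sum.cong) (auto simp: algebra_simps)
    also have "(\<Sum>i\<le>l. real (sphere_mult d i) * (sphere_eigval d l - sphere_eigval d i)) = T l"
      by (simp add: T_def flip: lessThan_Suc_atMost)
    also have "sphere_eigval d (Suc l) - sphere_eigval d l = 2 * real l + real d"
      by (simp add: sphere_eigval_def algebra_simps)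
    finally have "T (Suc l) = T l + (2 * real l + real d)\<^sup>2 * ?Q / fact d"
      using sum_sphere_mult_pochhammer[OF assms, of l] by (simp add: e power2_eq_square)
    moreover have "pochhammer (real l) d = real l * ?Q"
      unfolding e by (rule pochhammer_rec)
    moreover have "pochhammer (real (Suc l)) d = (real l + real d) * ?Q"
      unfolding e by (simp add: pochhammer_Suc add_ac)
    moreover have "4 * ((real l + real d) * (sphere_eigval d (Suc l) + real d * (real d - 2) / 4)
        - real l * (sphere_eigval d l + real d * (real d - 2) / 4))
        = (real d + 2) * (2 * real l + real d)\<^sup>2"
      by (simp add: sphere_eigval_def field_simps power2_eq_square)
    moreover have "4 / (D * F) * (b * Q) * u = 4 / (D * F) * (a * Q) * v + s * Q / F"
      if "4 * (b * u - a * v) = D * s" "D > 0" "F > 0" for D F Q a b u v s :: real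
    proof -
      have "b * u * 4 = D * s + 4 * a * v" using that by (simp add: algebra_simps)
      then have "Q * (b * u * 4) = Q * (D * s + 4 * a * v)" by simp
      then show ?thesis using that(2,3) by (simp add: field_simps)
    qed
    ultimately show ?case using Suc by simp
  qed
  finally show ?thesis .
qed

lemma sphere_eigval_bracket:
  assumes "d \<ge> 1" "t \<ge> 0"
  obtains l where "sphere_eigval d l \<le> t" "t \<le> sphere_eigval d (Suc l)"
proof -
  obtain n :: nat where "t < real n" using reals_Archimedean2 by blast
  then have ex: "t < sphere_eigval d n"
    using sphere_eigval_ge_level[OF assms(1), of n] by linarith
  define m where "m = (LEAST m. t < sphere_eigval d m)"
  have m: "t < sphere_eigval d m" unfolding m_def using ex by (rule LeastI)
  then obtain l where l: "m = Suc l"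
    using assms by (cases m) (auto simp: sphere_eigval_def)
  have "\<not> t < sphere_eigval d l"
    using not_less_Least[of l "\<lambda>m. t < sphere_eigval d m"] l by (simp add: m_def)
  then show ?thesis using that[of l] m l by simp
qed

text \<open>
  Between two consecutive eigenvalues the slope is the number of eigenvalues to the left.
\<close>

lemma riesz_mean1_affine:
  assumes "d \<ge> 1" "sphere_eigval d l \<le> t" "t \<le> sphere_eigval d (Suc l)"
  shows "riesz_mean1 d 1 t = riesz_mean1 d 1 (sphere_eigval d l)
    + (2 * real l + real d) * pochhammer (real l + 1) (d - 1) / fact d * (t - sphere_eigval d l)"
proof -
  note mono = sphere_eigval_mono[OF assms(1)]
  have "riesz_mean1 d 1 s = s * (\<Sum>i\<le>l. real (sphere_mult d i))
      - (\<Sum>i\<le>l. real (sphere_mult d i) * sphere_eigval d i)"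
    if "sphere_eigval d l \<le> s" "s \<le> sphere_eigval d (Suc l)" for s
  proof -
    have "s \<le> sphere_eigval d k ^ 1" if "k \<ge> Suc l" for k
      using mono[OF that] \<open>s \<le> _\<close> by simp
    moreover have "sphere_eigval d i \<le> s" if "i \<le> l" for i
      using mono[OF that] \<open>_ \<le> s\<close> by simp
    ultimately have "riesz_mean1 d 1 s = (\<Sum>i\<le>l. real (sphere_mult d i) * (s - sphere_eigval d i))"
      by (subst riesz_mean1_eq_sum[OF assms(1), of "Suc l"])
        (auto simp: lessThan_Suc_atMost intro!: sum.cong)
    then show ?thesis
      by (simp add: right_diff_distrib sum_subtractf sum_distrib_left mult.commute)
  qed
  from this[of t] this[of "sphere_eigval d l"] assms(2,3) mono[of l "Suc l"]
  have "riesz_mean1 d 1 t - riesz_mean1 d 1 (sphere_eigval d l) =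
      (\<Sum>i\<le>l. real (sphere_mult d i)) * (t - sphere_eigval d l)"
    by (simp add: algebra_simps)
  then show ?thesis
    using sum_sphere_mult_pochhammer[OF assms(1), of l] by simp
qed

section \<open>Sharp bounds for the Laplacian\<close>

text \<open>
  Convexity of the power function, including the end point 0 that \<open>powr_convex\<close> leaves out. The
  chord inequality follows from two tangents at the same intermediate point.
\<close>

lemma powr_above_tangent:
  fixes x c a :: real
  assumes "x \<ge> 0" "c \<ge> 0" "a > 1"
  shows "c powr a + a * c powr (a - 1) * (x - c) \<le> x powr a"
proof (cases "c = 0 \<or> x = 0")
  case False
  then have "x > 0" "c > 0" using assms by auto
  have "a * c powr (a - 1) * (x - c) \<le> x powr a - c powr a"
  proof (rule convex_on_imp_above_tangent[where A = "{0<..}"])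
    show "((\<lambda>x. x powr a) has_field_derivative a * c powr (a - 1)) (at c within {0<..})"
      using \<open>c > 0\<close> by (auto intro!: derivative_eq_intros)
  qed (use assms \<open>x > 0\<close> \<open>c > 0\<close> in \<open>auto intro: powr_convex simp: interior_open\<close>)
  then show ?thesis by simp
next
  case True
  have "c * c powr (a - 1) = c powr a"
    using powr_mult_base[of c "a - 1"] assms by simp
  then have "c powr a + a * c powr (a - 1) * (0 - c) = (1 - a) * c powr a"
    by (simp add: algebra_simps)
  also have "\<dots> \<le> 0"
    using assms by (intro mult_nonpos_nonneg) auto
  finally show ?thesis using True assms by auto
qed

lemma powr_below_chord:
  fixes x y u a :: real
  assumes "x \<ge> 0" "y \<ge> 0" "0 \<le> u" "u \<le> 1" "a > 1"
  shows "((1 - u) * x + u * y) powr a \<le> (1 - u) * x powr a + u * y powr a"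
proof -
  define c where "c = (1 - u) * x + u * y"
  define k where "k = a * c powr (a - 1)"
  have "c \<ge> 0" using assms by (simp add: c_def)
  then have "(1 - u) * (c powr a + k * (x - c)) + u * (c powr a + k * (y - c))
      \<le> (1 - u) * x powr a + u * y powr a"
    unfolding k_def using assms by (intro add_mono mult_left_mono powr_above_tangent) auto
  also have "(1 - u) * (c powr a + k * (x - c)) + u * (c powr a + k * (y - c))
      = c powr a + k * ((1 - u) * x + u * y - c)"
    by (simp add: algebra_simps)
  finally show ?thesis by (simp add: c_def)
qed

text \<open>
  The square of the product is a product over \<open>i\<close> of
  \<open>(l + i) * (l + d - 1 - i) = l * (l + d - 1) + i * (d - 1 - i)\<close>, and each factor is at least the
  eigenvalue.
\<close>

lemma sphere_eigval_powr_le_pochhammer: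
  assumes "d \<ge> 1"
  shows "sphere_eigval d l powr (real d / 2) \<le> pochhammer (real l) d"
proof -
  have nonneg: "pochhammer (real l) d \<ge> 0"
    unfolding pochhammer_prod by (intro prod_nonneg) auto
  have rev: "pochhammer (real l) d = (\<Prod>i<d. real l + real d - 1 - real i)"
    unfolding pochhammer_prod lessThan_atLeast0[symmetric]
    by (subst prod.nat_diff_reindex[symmetric]) (auto intro!: prod.cong simp: of_nat_diff)
  have "sphere_eigval d l ^ d = (\<Prod>i<d. sphere_eigval d l)"
    by simp
  also have "\<dots> \<le> (\<Prod>i<d. (real l + real i) * (real l + real d - 1 - real i))"
  proof (intro prod_mono conjI sphere_eigval_nonneg assms)
    fix i assume "i \<in> {..<d}"
    then have "real i * (real d - 1 - real i) \<ge> 0" by simp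
    then show "sphere_eigval d l \<le> (real l + real i) * (real l + real d - 1 - real i)"
      by (simp add: sphere_eigval_def algebra_simps)
  qed
  also have "\<dots> = (pochhammer (real l) d)\<^sup>2"
    unfolding prod.distrib power2_eq_square rev[symmetric]
    by (simp add: pochhammer_prod lessThan_atLeast0)
  finally have "sphere_eigval d l ^ d \<le> (pochhammer (real l) d)\<^sup>2" .
  moreover have "(sphere_eigval d l powr (real d / 2))\<^sup>2 = sphere_eigval d l ^ d"
    using assms sphere_eigval_nonneg[OF assms, of l]
    by (simp add: power2_eq_square powr_add[symmetric] powr_realpow')
  ultimately show ?thesis
    using nonneg by (metis power2_le_imp_le)
qed

lemma riesz_mean1_laplacian_ge:
  assumes "d \<ge> 2" "t \<ge> 0"
  shows "4 / ((real d + 2) * fact d) * t powr (1 + real d / 2) \<le> riesz_mean1 d 1 t"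
proof -
  define C where "C = 4 / ((real d + 2) * fact d)"
  define a where "a = 1 + real d / 2"
  have d: "d \<ge> 1" using assms by simp
  have "C \<ge> 0" by (simp add: C_def)
  have "a > 1" using assms by (simp add: a_def)
  have node: "C * sphere_eigval d l powr a \<le> riesz_mean1 d 1 (sphere_eigval d l)" for l
  proof -
    let ?x = "sphere_eigval d l"
    have x: "?x \<ge> 0" using sphere_eigval_nonneg[OF d] .
    have "C * ?x powr a = C * (?x powr (real d / 2) * ?x)"
      using x by (simp add: a_def powr_mult_base mult.commute)
    also have "\<dots> \<le> C * (pochhammer (real l) d * (?x + real d * (real d - 2) / 4))"
      using assms x \<open>C \<ge> 0\<close> sphere_eigval_powr_le_pochhammer[OF d, of l]
      by (intro mult_left_mono mult_mono) (auto intro: order_trans[OF powr_ge_zero])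
    finally show ?thesis
      unfolding riesz_mean1_eigval[OF d] C_def by (simp only: mult.assoc)
  qed
  obtain l where l: "sphere_eigval d l \<le> t" "t \<le> sphere_eigval d (Suc l)"
    using sphere_eigval_bracket[OF d assms(2)] .
  define x where "x = sphere_eigval d l"
  define y where "y = sphere_eigval d (Suc l)"
  have "x < y" unfolding x_def y_def
    using strict_mono_sphere_eigval[OF d] by (simp add: strict_mono_less)
  define u where "u = (t - x) / (y - x)"
  have u: "0 \<le> u" "u \<le> 1" using l \<open>x < y\<close> by (auto simp: u_def x_def y_def)
  have t_x: "t - x = u * (y - x)" using \<open>x < y\<close> by (simp add: u_def)
  then have t: "t = (1 - u) * x + u * y" by (simp add: algebra_simps)
  define k where "k = (2 * real l + real d) * pochhammer (real l + 1) (d - 1) / fact d"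
  have Rt: "riesz_mean1 d 1 t = riesz_mean1 d 1 x + k * (t - x)"
    using riesz_mean1_affine[OF d l] by (simp add: x_def k_def)
  have Ry: "riesz_mean1 d 1 y = riesz_mean1 d 1 x + k * (y - x)"
    using riesz_mean1_affine[OF d, of l y] \<open>x < y\<close> by (simp add: x_def y_def k_def)
  have "C * t powr a \<le> C * ((1 - u) * x powr a + u * y powr a)"
    unfolding t using u \<open>a > 1\<close> \<open>C \<ge> 0\<close> sphere_eigval_nonneg[OF d]
    by (intro mult_left_mono powr_below_chord) (auto simp: x_def y_def)
  also have "\<dots> = (1 - u) * (C * x powr a) + u * (C * y powr a)"
    by (simp add: algebra_simps)
  also have "\<dots> \<le> (1 - u) * riesz_mean1 d 1 x + u * riesz_mean1 d 1 y"
    using u node[of l] node[of "Suc l"] unfolding x_def y_def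
    by (intro add_mono mult_left_mono) auto
  also have "\<dots> = riesz_mean1 d 1 t"
    unfolding Rt Ry t_x by (simp add: algebra_simps)
  finally show ?thesis by (simp add: C_def a_def)
qed

text \<open>
  Up to a constant the slope of the Riesz mean at level \<open>l\<close> is the base on the left. With
  \<open>x = l + d/2\<close>, its square is a product of \<open>d\<close> factors, namely \<open>x\<^sup>2\<close> and
  \<open>(l + i) * (l + d - i) = x\<^sup>2 - (d/2 - i)\<^sup>2\<close> for \<open>1 \<le> i < d\<close>; the right-hand side is the arithmetic mean
  of these factors.
\<close>

lemma slope_root_le:
  assumes "d \<ge> 1"
  shows "((real l + real d / 2) * pochhammer (real l + 1) (d - 1)) powr (2 / real d)
    \<le> (real l + real d / 2)\<^sup>2 - (real d - 1) * (real d - 2) / 12"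
proof -
  obtain e where e: "d = Suc e" using assms by (cases d) auto
  define x where "x = real l + real d / 2"
  define Q where "Q = pochhammer (real l + 1) e"
  define f where "f i = (if i = 0 then x\<^sup>2 else (real l + real i) * (real l + real d - real i))" for i
  have Q: "Q \<ge> 0" unfolding Q_def by (rule pochhammer_nonneg) simp
  have "x \<ge> 0" by (simp add: x_def)
  have rev: "Q = (\<Prod>i<e. real l + real e - real i)"
    unfolding Q_def pochhammer_prod lessThan_atLeast0[symmetric]
    by (subst prod.nat_diff_reindex[symmetric]) (auto intro!: prod.cong simp: of_nat_diff)
  have "(\<Prod>i<d. f i) = x\<^sup>2 * (\<Prod>i<e. (real l + 1 + real i) * (real l + real e - real i))"
    unfolding e prod.lessThan_Suc_shift by (auto simp: f_def e add_ac intro!: prod.cong)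
  also have "\<dots> = (x * Q)\<^sup>2"
    unfolding prod.distrib rev[symmetric]
    by (simp add: Q_def pochhammer_prod lessThan_atLeast0 power_mult_distrib power2_eq_square)
  finally have prod_f: "(\<Prod>i<d. f i) = (x * Q)\<^sup>2" .
  have closed: "(\<Sum>i<n. (real l + 1 + real i) * (real l + real e - real i)) =
      real n * (real l + 1) * (real l + real e) + (real e - 1) * (real n * (real n - 1) / 2)
      - (real n - 1) * real n * (2 * real n - 1) / 6" for n
    by (induction n) (simp_all add: field_simps)
  have sum_split: "(\<Sum>i<d. f i) = x\<^sup>2 + (\<Sum>i<e. (real l + 1 + real i) * (real l + real e - real i))"
    unfolding e sum.lessThan_Suc_shift by (auto simp: f_def e add_ac intro!: sum.cong)
  have sum_f: "(\<Sum>i<d. f i) = real d * (x\<^sup>2 - (real d - 1) * (real d - 2) / 12)"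
    unfolding sum_split closed by (simp add: e x_def field_simps power2_eq_square)
  have "(\<Prod>i<d. f i) powr (1 / card {..<d}) \<le> (\<Sum>i<d. f i / card {..<d})"
    using assms by (intro arith_geom_mean) (auto simp: f_def lessThan_empty_iff)
  then have "((x * Q)\<^sup>2) powr (1 / real d) \<le> x\<^sup>2 - (real d - 1) * (real d - 2) / 12"
    using assms by (simp add: prod_f sum_f sum_divide_distrib[symmetric])
  moreover have "(x * Q)\<^sup>2 = (x * Q) powr 2"
    using Q \<open>x \<ge> 0\<close> by simp
  then have "((x * Q)\<^sup>2) powr (1 / real d) = (x * Q) powr (2 / real d)"
    by (simp only: powr_powr) simp
  ultimately show ?thesis by (simp add: x_def Q_def e)
qed

lemma riesz_mean1_laplacian_le:
  assumes "d \<ge> 2" "t \<ge> 0"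
  shows "riesz_mean1 d 1 t \<le> 4 / ((real d + 2) * fact d) * (t + z_shift d) powr (1 + real d / 2)"
proof -
  define C where "C = 4 / ((real d + 2) * fact d)"
  define a where "a = 1 + real d / 2"
  have d: "d \<ge> 1" using assms by simp
  obtain e where e: "d = Suc e" using d by (cases d) auto
  have "C \<ge> 0" by (simp add: C_def)
  have "a > 1" using assms by (simp add: a_def)
  have "z_shift d \<ge> 0" using d by (simp add: z_shift_def)
  obtain l where l: "sphere_eigval d l \<le> t" "t \<le> sphere_eigval d (Suc l)"
    using sphere_eigval_bracket[OF d assms(2)] .
  define v where "v = sphere_eigval d l"
  define Q where "Q = pochhammer (real l + 1) (d - 1)"
  define A where "A = (real l + real d / 2) * Q"
  \<comment> \<open>The comparison function \<open>C * y powr a\<close> has slope \<open>C * (a * A)\<close>, which is the slope of the Riesz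
    mean on this piece, exactly at \<open>y = B\<close>.\<close>
  define B where "B = A powr (2 / real d)"
  have "Q > 0" unfolding Q_def by (rule pochhammer_pos) simp
  then have "A > 0" using d by (simp add: A_def add_nonneg_pos)
  have B_A: "B powr (a - 1) = A"
    using \<open>A > 0\<close> d by (simp add: B_def a_def powr_powr)
  have B_a: "B powr a = A * B"
    using B_A \<open>A > 0\<close> powr_mult_base[of B "a - 1"] by (simp add: B_def mult.commute)
  have B_le: "B \<le> (real l + real d / 2)\<^sup>2 - (real d - 1) * (real d - 2) / 12"
    unfolding B_def A_def Q_def by (rule slope_root_le[OF d])
  have "real d + 2 = 2 * a" by (simp add: a_def)
  then have "C * a = 2 / fact d" using \<open>a > 1\<close> by (simp add: C_def)
  moreover have "(2 * real l + real d) * Q / fact d = 2 / fact d * A"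
    by (simp add: A_def field_simps)
  ultimately have slope: "(2 * real l + real d) * Q / fact d = C * (a * A)"
    by (simp only: mult.assoc[symmetric])
  have poch: "pochhammer (real l) d = real l * Q"
    unfolding Q_def e by (simp add: pochhammer_rec)
  \<comment> \<open>The tangent at \<open>B\<close>, taken at the kink and divided by \<open>C * Q\<close>, dominates the value of the Riesz
    mean there. With the arithmetic mean in place of \<open>B\<close> this is an identity.\<close>
  have value_le: "real l * (v + real d * (real d - 2) / 4)
      \<le> (real l + real d / 2) * (B + a * (v + z_shift d - B))"
  proof -
    have "real l * (v + real d * (real d - 2) / 4) =
        (real l + real d / 2) * (a * (v + z_shift d) - real d / 2 *
          ((real l + real d / 2)\<^sup>2 - (real d - 1) * (real d - 2) / 12))"
      by (simp add: v_def sphere_eigval_def a_def z_shift_def field_simps power2_eq_square)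
    also have "\<dots> \<le> (real l + real d / 2) * (a * (v + z_shift d) - real d / 2 * B)"
      using B_le by (intro mult_left_mono diff_left_mono) auto
    also have "a * (v + z_shift d) - real d / 2 * B = B + a * (v + z_shift d - B)"
      by (simp add: a_def field_simps)
    finally show ?thesis .
  qed
  have "riesz_mean1 d 1 t = C * (Q * (real l * (v + real d * (real d - 2) / 4)) + a * A * (t - v))"
    unfolding riesz_mean1_affine[OF d l] riesz_mean1_eigval[OF d]
    unfolding poch Q_def[symmetric] slope C_def[symmetric] v_def[symmetric]
    by (simp only: distrib_left mult_ac)
  also have "\<dots> \<le> C * (Q * ((real l + real d / 2) * (B + a * (v + z_shift d - B))) + a * A * (t - v))"
    using \<open>C \<ge> 0\<close> \<open>Q > 0\<close> value_le by (intro mult_left_mono add_right_mono) auto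
  also have "\<dots> = C * (B powr a + a * B powr (a - 1) * (t + z_shift d - B))"
    unfolding B_A B_a by (simp add: A_def field_simps)
  also have "\<dots> \<le> C * (t + z_shift d) powr a"
    using \<open>C \<ge> 0\<close> \<open>a > 1\<close> assms \<open>z_shift d \<ge> 0\<close>
    by (intro mult_left_mono powr_above_tangent) (auto simp: B_def)
  finally show ?thesis by (simp add: C_def a_def)
qed

section \<open>Passage to powers of the Laplacian\<close>

text \<open>
  Taylor's formula with integral remainder for \<open>t ^ p\<close>, expanded at \<open>w\<close> and evaluated at \<open>x\<close>, in a form
  that remains valid for \<open>x > w\<close>, when both sides vanish.
\<close>

lemma truncated_power_integral:
  fixes x w :: real
  assumes "x \<ge> 0" "w \<ge> 0" "p \<ge> 2"
  shows "((\<lambda>t. real p * (real p - 1) * t ^ (p - 2) * max (t - x) 0) has_integral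
    real p * w ^ (p - 1) * max (w - x) 0 - max (w ^ p - x ^ p) 0) {0..w}"
proof -
  obtain q where q: "p = Suc (Suc q)" using assms(3) by (metis add_2_eq_Suc le_Suc_ex)
  define F where "F t = real p * t ^ (p - 1) * max (t - x) 0 - max (t ^ p - x ^ p) 0" for t
  have below: "F t = 0" if "0 \<le> t" "t \<le> x" for t
    using that power_mono[of t x p] by (simp add: F_def)
  have above: "F t = real p * t ^ Suc q * (t - x) - (t ^ p - x ^ p)" if "x \<le> t" for t
    using that assms(1) power_mono[of x t p] by (simp add: F_def q)
  have "((\<lambda>t. real p * (real p - 1) * t ^ (p - 2) * max (t - x) 0) has_integral F w - F 0) {0..w}"
  proof (rule fundamental_theorem_of_calculus_interior_strong[where S = "{x}"])
    show "continuous_on {0..w} F" unfolding F_def by (intro continuous_intros)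
    fix t assume t: "t \<in> {0<..<w} - {x}"
    show "(F has_vector_derivative real p * (real p - 1) * t ^ (p - 2) * max (t - x) 0) (at t)"
    proof (cases "t < x")
      case True
      have "((\<lambda>_. 0) has_vector_derivative 0) (at t)" by simp
      then have "(F has_vector_derivative 0) (at t)"
        by (rule has_vector_derivative_transform_within_open[where S = "{0<..<x}"])
          (use t True below in auto)
      then show ?thesis using True by simp
    next
      case False
      have "((\<lambda>t. real p * t ^ Suc q * (t - x) - (t ^ p - x ^ p)) has_real_derivative
          real p * (real p - 1) * t ^ q * (t - x)) (at t)"
        by (rule derivative_eq_intros refl)+ (simp add: q algebra_simps)
      then have "((\<lambda>t. real p * t ^ Suc q * (t - x) - (t ^ p - x ^ p)) has_vector_derivative
          real p * (real p - 1) * t ^ q * (t - x)) (at t)"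
        by (simp add: has_real_derivative_iff_has_vector_derivative)
      then have "(F has_vector_derivative real p * (real p - 1) * t ^ q * (t - x)) (at t)"
        by (rule has_vector_derivative_transform_within_open[where S = "{x<..}"])
          (use t False above in auto)
      then show ?thesis using t False by (simp add: q)
    qed
  qed (use assms in auto)
  moreover have "F 0 = 0" using below[of 0] assms by simp
  ultimately show ?thesis by (simp add: F_def)
qed

text \<open>
  Expresses the Riesz mean of a power of the Laplacian through that of the Laplacian itself. The
  integrand is a finite sum over the levels that have an eigenvalue below \<open>w\<close>.
\<close>

lemma riesz_mean1_power_integral:
  assumes "d \<ge> 1" "p \<ge> 2" "w \<ge> 0"
  shows "((\<lambda>t. real p * (real p - 1) * t ^ (p - 2) * riesz_mean1 d 1 t) has_integral
    real p * w ^ (p - 1) * riesz_mean1 d 1 w - riesz_mean1 d p (w ^ p)) {0..w}"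
proof -
  obtain n :: nat where "w < real n" using reals_Archimedean2 by blast
  have large: "w \<le> sphere_eigval d l" if "l \<ge> n" for l
    using sphere_eigval_ge_level[OF assms(1), of l] \<open>w < real n\<close> that by simp
  have R1: "riesz_mean1 d 1 t = (\<Sum>i<n. real (sphere_mult d i) * max (t - sphere_eigval d i) 0)"
    if "t \<le> w" for t
  proof -
    have "t \<le> sphere_eigval d l ^ 1" if "l \<ge> n" for l
      using large[OF that] \<open>t \<le> w\<close> by simp
    from riesz_mean1_eq_sum[OF assms(1) this] show ?thesis by simp
  qed
  have Rp: "riesz_mean1 d p (w ^ p) =
      (\<Sum>i<n. real (sphere_mult d i) * max (w ^ p - sphere_eigval d i ^ p) 0)"
    using large assms(3) by (intro riesz_mean1_eq_sum[OF assms(1)] power_mono)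
  have "((\<lambda>t. \<Sum>i<n. real (sphere_mult d i) *
        (real p * (real p - 1) * t ^ (p - 2) * max (t - sphere_eigval d i) 0)) has_integral
      (\<Sum>i<n. real (sphere_mult d i) * (real p * w ^ (p - 1) * max (w - sphere_eigval d i) 0
        - max (w ^ p - sphere_eigval d i ^ p) 0))) {0..w}"
    by (intro has_integral_sum has_integral_mult_right truncated_power_integral
        sphere_eigval_nonneg assms finite_lessThan)
  also have "(\<Sum>i<n. real (sphere_mult d i) * (real p * w ^ (p - 1) * max (w - sphere_eigval d i) 0
        - max (w ^ p - sphere_eigval d i ^ p) 0))
      = real p * w ^ (p - 1) * riesz_mean1 d 1 w - riesz_mean1 d p (w ^ p)"
    unfolding Rp R1[OF order_refl] by (simp add: algebra_simps sum_subtractf sum_distrib_left)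
  finally show ?thesis
  proof (rule has_integral_eq[rotated])
    fix t assume "t \<in> {0..w}"
    then have "t \<le> w" by simp
    show "(\<Sum>i<n. real (sphere_mult d i) *
        (real p * (real p - 1) * t ^ (p - 2) * max (t - sphere_eigval d i) 0)) =
      real p * (real p - 1) * t ^ (p - 2) * riesz_mean1 d 1 t"
      unfolding R1[OF \<open>t \<le> w\<close>] sum_distrib_left by (simp only: mult_ac)
  qed
qed

lemma shifted_powr_integral:
  fixes b s w :: real
  assumes "b > 0" "s \<ge> 0" "w \<ge> 0"
  shows "((\<lambda>t. (t + s) powr (b - 1)) has_integral ((w + s) powr b - s powr b) / b) {0..w}"
proof -
  have "((\<lambda>t. (t + s) powr (b - 1)) has_integral (w + s) powr b / b - (0 + s) powr b / b) {0..w}"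
  proof (rule fundamental_theorem_of_calculus_interior)
    show "continuous_on {0..w} (\<lambda>t. (t + s) powr b / b)"
      using assms by (intro continuous_intros continuous_on_powr') auto
    fix t assume "t \<in> {0<..<w}"
    then have "((\<lambda>t. (t + s) powr b / b) has_real_derivative (t + s) powr (b - 1)) (at t)"
      using assms by (auto intro!: derivative_eq_intros)
    then show "((\<lambda>t. (t + s) powr b / b) has_vector_derivative (t + s) powr (b - 1)) (at t)"
      by (simp add: has_real_derivative_iff_has_vector_derivative)
  qed (use assms in auto)
  then show ?thesis by (simp add: diff_divide_distrib)
qed

lemma power_times_powr:
  fixes x a :: real
  assumes "x \<ge> 0" "a > 0"
  shows "x ^ n * x powr a = x powr (real n + a)"
  using assms by (cases "x = 0") (auto simp: powr_add powr_realpow)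

theorem theorem6p1p1:
  fixes d p :: nat and z :: real
  assumes "d \<ge> 2" and "p \<ge> 2" and "z \<ge> 0"
  shows "riesz_mean1 d p z \<ge>
           L_class 1 d p * sphere_area d * z powr (1 + real d / (2 * real p))
           - 2 * (real p - 1) / (real d + 2) * L_class 1 d p * sphere_area d *
             ((z powr (1 / real p) + z_shift d) powr (real d / 2 + real p)
              - z powr (1 + real d / (2 * real p)))
       \<and> riesz_mean1 d p z \<le>
           L_class 1 d p * sphere_area d *
             (z powr (1 / real p) + z_shift d) powr (real d / 2 + real p)
           + 2 * (real p - 1) / (real d + 2) * L_class 1 d p * sphere_area d *
             ((z powr (1 / real p) + z_shift d) powr (real d / 2 + real p)
              - z powr (1 + real d / (2 * real p)))"
proof -
  define C where "C = 4 / ((real d + 2) * fact d)"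
  define a where "a = 1 + real d / 2"
  define b where "b = real d / 2 + real p"
  define s where "s = z_shift d"
  define w where "w = z powr (1 / real p)"
  define U where "U = w powr b"
  define V where "V = (w + s) powr b"
  define m where "m = p - 2"
  have p: "p = m + 2" using assms by (simp add: m_def)
  have "C \<ge> 0" by (simp add: C_def)
  have "a > 0" "b > 0" using assms by (simp_all add: a_def b_def add_pos_nonneg add_nonneg_pos)
  have "s \<ge> 0" using assms by (simp add: s_def z_shift_def)
  have "w \<ge> 0" by (simp add: w_def)
  have w_p: "w ^ p = z"
    using assms by (subst powr_realpow'[symmetric]) (auto simp: w_def powr_powr)
  have U_z: "z powr (1 + real d / (2 * real p)) = U"
    using assms by (simp add: U_def w_def b_def powr_powr add_divide_distrib add.commute)
  have exponents: "real m + a = b - 1" "real (p - 1) + a = b"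
    by (simp_all add: a_def b_def p)
  have R_ge: "C * t powr a \<le> riesz_mean1 d 1 t"
    and R_le: "riesz_mean1 d 1 t \<le> C * (t + s) powr a" if "t \<ge> 0" for t
    using riesz_mean1_laplacian_ge[OF assms(1) that] riesz_mean1_laplacian_le[OF assms(1) that]
    by (simp_all add: C_def a_def s_def)
  define k where "k = real p * (real p - 1)"
  have "k \<ge> 0" using assms by (simp add: k_def)
  have R: "((\<lambda>t. k * t ^ m * riesz_mean1 d 1 t) has_integral
      real p * w ^ (p - 1) * riesz_mean1 d 1 w - riesz_mean1 d p z) {0..w}"
    using riesz_mean1_power_integral[of d p w] assms \<open>w \<ge> 0\<close> unfolding w_p k_def m_def by simp

  \<comment> \<open>Replacing \<open>t ^ m\<close> by \<open>(t + s) ^ m\<close> makes the majorant an exact derivative.\<close>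
  have "real p * w ^ (p - 1) * riesz_mean1 d 1 w - riesz_mean1 d p z
      \<le> k * C * ((V - s powr b) / b)"
    unfolding V_def
  proof (rule has_integral_le[OF R has_integral_mult_right[OF shifted_powr_integral]])
    fix t assume "t \<in> {0..w}"
    then have t: "t \<ge> 0" by simp
    have "t ^ m * riesz_mean1 d 1 t \<le> (t + s) ^ m * (C * (t + s) powr a)"
      using t \<open>s \<ge> 0\<close> \<open>C \<ge> 0\<close> R_le[OF t] order_trans[OF _ R_ge[OF t]]
      by (intro mult_mono power_mono) auto
    also have "\<dots> = C * (t + s) powr (b - 1)"
      using power_times_powr[of "t + s" a m] t \<open>s \<ge> 0\<close> \<open>a > 0\<close> exponents by (simp add: mult_ac)
    finally show "k * t ^ m * riesz_mean1 d 1 t \<le> k * C * (t + s) powr (b - 1)"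
      using \<open>k \<ge> 0\<close> mult_left_mono by (fastforce simp: mult.assoc)
  qed (use \<open>b > 0\<close> \<open>s \<ge> 0\<close> \<open>w \<ge> 0\<close> in auto)
  also have "\<dots> \<le> k * C * (V / b)"
    using \<open>k \<ge> 0\<close> \<open>C \<ge> 0\<close> \<open>b > 0\<close> by (intro mult_left_mono divide_right_mono) auto
  finally have int_le: "real p * w ^ (p - 1) * riesz_mean1 d 1 w - riesz_mean1 d p z \<le> k * C * (V / b)" .

  have int_ge: "k * C * ((U - 0) / b) \<le> real p * w ^ (p - 1) * riesz_mean1 d 1 w - riesz_mean1 d p z"
  proof (rule has_integral_le[OF _ R])
    show "((\<lambda>t. k * C * t powr (b - 1)) has_integral k * C * ((U - 0) / b)) {0..w}"
      unfolding U_def using has_integral_mult_right[OF shifted_powr_integral[of b 0 w]] \<open>b > 0\<close> \<open>w \<ge> 0\<close>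
      by simp
    fix t assume "t \<in> {0..w}"
    then have t: "t \<ge> 0" by simp
    have "C * t powr (b - 1) = t ^ m * (C * t powr a)"
      using power_times_powr[of t a m] t \<open>a > 0\<close> exponents by (simp add: mult_ac)
    also have "\<dots> \<le> t ^ m * riesz_mean1 d 1 t"
      using t R_ge[OF t] by (intro mult_left_mono) auto
    finally show "k * C * t powr (b - 1) \<le> k * t ^ m * riesz_mean1 d 1 t"
      using \<open>k \<ge> 0\<close> mult_left_mono by (fastforce simp: mult.assoc)
  qed

  have "C * U = w ^ (p - 1) * (C * w powr a)"
    using power_times_powr[of w a "p - 1", unfolded exponents] \<open>w \<ge> 0\<close> \<open>a > 0\<close>
    by (simp add: U_def mult_ac)
  also have "\<dots> \<le> w ^ (p - 1) * riesz_mean1 d 1 w"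
    using \<open>w \<ge> 0\<close> R_ge by (intro mult_left_mono) auto
  finally have bd_ge: "real p * (C * U) \<le> real p * (w ^ (p - 1) * riesz_mean1 d 1 w)"
    by (intro mult_left_mono) auto

  have "w ^ (p - 1) * riesz_mean1 d 1 w \<le> (w + s) ^ (p - 1) * (C * (w + s) powr a)"
    using \<open>w \<ge> 0\<close> \<open>s \<ge> 0\<close> \<open>C \<ge> 0\<close> R_le order_trans[OF _ R_ge]
    by (intro mult_mono power_mono) auto
  also have "\<dots> = C * V"
    using power_times_powr[of "w + s" a "p - 1", unfolded exponents] \<open>w \<ge> 0\<close> \<open>s \<ge> 0\<close> \<open>a > 0\<close>
    by (simp add: V_def mult_ac)
  finally have bd_le: "real p * (w ^ (p - 1) * riesz_mean1 d 1 w) \<le> real p * (C * V)"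
    by (intro mult_left_mono) auto

  define K where "K = L_class 1 d p * sphere_area d"
  have K: "K = real p * C * a / b"
  proof -
    have "real d + 2 = 2 * a" "2 * real p + real d = 2 * b"
      by (simp_all add: a_def b_def)
    then show ?thesis
      using L_class_times_sphere_area[of p d] assms(2) \<open>a > 0\<close> \<open>b > 0\<close>
      by (simp add: K_def C_def mult.commute)
  qed
  have corr: "2 * (real p - 1) / (real d + 2) = (real p - 1) / a"
    by (simp add: a_def field_simps)
  \<comment> \<open>Because of this relation, \<open>1 - (p - 1) / b\<close> equals \<open>a / b\<close>, which turns the bounds obtained into
    the semiclassical term plus a multiple of \<open>V - U\<close>.\<close>
  have b_a: "b = a + (real p - 1)" by (simp add: a_def b_def)
  have lower: "K * U - (real p - 1) / a * K * (V - U) = real p * (C * U) - k * C * (V / b)"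
    and upper: "K * V + (real p - 1) / a * K * (V - U) = real p * (C * V) - k * C * ((U - 0) / b)"
    using \<open>a > 0\<close> \<open>b > 0\<close> unfolding K k_def
    by (simp_all add: divide_simps) (simp_all add: b_a algebra_simps)
  have "K * U - (real p - 1) / a * K * (V - U) \<le> riesz_mean1 d p z"
    using int_le bd_ge unfolding lower by (simp add: mult.assoc)
  moreover have "riesz_mean1 d p z \<le> K * V + (real p - 1) / a * K * (V - U)"
    using int_ge bd_le unfolding upper by (simp add: mult.assoc)
  ultimately show ?thesis
    unfolding U_z w_def[symmetric] s_def[symmetric] b_def[symmetric] V_def[symmetric] corr
    by (simp add: K_def mult.assoc)
qed

end
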